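(* Let $f\colon\mathbb{N}\to\mathbb{C}$ be bounded, $\ell\in\mathbb{C}$, and $W(x)=e^{\sqrt{x}}$. Consider the statements: (i) there exists a function $V$ belonging to a Hardy field with $\lim_{N\to\infty}\frac{\log W(N)}{\log V(N)}=0$ such that $\lim_{N\to\infty}\mathbb{E}_{n\in[N-s(N),N]}f(n)=\ell$ for every $s\colon\mathbb{N}\to\mathbb{N}$ with $\lim_{N\to\infty}s(N)\cdot\Delta\log(V(N))=\infty$; (ii) $\lim_{N\to\infty}\mathbb{E}^W_{n\le N}f(n)=\ell$; (iii) $\lim_{N\to\infty}\mathbb{E}^{2\mathrm{bin}}_{n\le N}f(n)=\ell$. Then (i) implies (ii), and (ii) implies (iii).
   Context: For a function $U$ on $\mathbb{N}$, $\Delta U(N)=U(N)-U(N-1)$ for $N\ge2$ and $\Delta U(1)=U(1)$. $\mathbb{E}^W_{n\le N}f(n)=\frac{1}{W(N)}\sum_{n=1}^N\Delta W(n)f(n)$. $\mathbb{E}_{n\in[a,b]}f(n)=\frac{1}{b-a}\sum_{n=a}^bf(n)$. $\mathbb{E}^{2\mathrm{bin}}_{n\le N}f(n)=\frac{1}{2^{N+1}}\sum_{n=1}^{2N}\binom{N}{\lfloor n/2\rfloor}f(n)$. A Hardy field is a field of germs at $\infty$ of real-valued differentiable functions closed under differentiation.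
   Formalization: In (i) the function V is additionally required to tend to infinity; without this, V(x)=e^{-x} satisfies the ratio condition while no s satisfies the growth condition, so (i) holds vacuously and (i) ⇒ (ii) fails (e.g. f=0, ℓ=1). *)

theory Defs
  imports "HOL-Analysis.Analysis"
begin

section \<open>Germs at infinity and Hardy fields\<close>

(* A function defined only on some half-line is represented by an arbitrary total
   extension; its values below the half-line do not affect the germ. *)

definition germ_eq :: "(real \<Rightarrow> real) \<Rightarrow> (real \<Rightarrow> real) \<Rightarrow> bool" where
  "germ_eq f g \<longleftrightarrow> (\<forall>\<^sub>F x in at_top. f x = g x)"

lemma equivp_germ_eq: "equivp germ_eq"
proof (rule equivpI)
  show "reflp germ_eq"
    by (simp add: reflp_def germ_eq_def)
  show "symp germ_eq"
    by (simp add: symp_def germ_eq_def eq_commute)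
  show "transp germ_eq"
    unfolding transp_def germ_eq_def by (auto elim: eventually_elim2)
qed

quotient_type germ = "real \<Rightarrow> real" / germ_eq
  morphisms rep_germ germ_of
  by (rule equivp_germ_eq)

instantiation germ :: comm_ring_1
begin

lift_definition zero_germ :: germ is "\<lambda>x. 0" .

lift_definition one_germ :: germ is "\<lambda>x. 1" .

lift_definition plus_germ :: "germ \<Rightarrow> germ \<Rightarrow> germ" is "\<lambda>f g x. f x + g x"
  unfolding germ_eq_def by (auto elim: eventually_elim2)

lift_definition minus_germ :: "germ \<Rightarrow> germ \<Rightarrow> germ" is "\<lambda>f g x. f x - g x"
  unfolding germ_eq_def by (auto elim: eventually_elim2)

lift_definition uminus_germ :: "germ \<Rightarrow> germ" is "\<lambda>f x. - f x"
  unfolding germ_eq_def by (auto elim: eventually_mono)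

lift_definition times_germ :: "germ \<Rightarrow> germ \<Rightarrow> germ" is "\<lambda>f g x. f x * g x"
  unfolding germ_eq_def by (auto elim: eventually_elim2)

instance
  by standard (transfer; simp add: germ_eq_def algebra_simps)+

end

definition hardy_field :: "germ set \<Rightarrow> bool" where
  "hardy_field H \<longleftrightarrow>
     0 \<in> H \<and> 1 \<in> H \<and>
     (\<forall>a\<in>H. \<forall>b\<in>H. a + b \<in> H \<and> a * b \<in> H) \<and>
     (\<forall>a\<in>H. - a \<in> H) \<and>
     (\<forall>a\<in>H. a \<noteq> 0 \<longrightarrow> (\<exists>b\<in>H. a * b = 1)) \<and>
     (\<forall>a\<in>H. \<exists>f f'. a = germ_of f \<and>
        (\<forall>\<^sub>F x in at_top. (f has_real_derivative f' x) (at x)) \<and> germ_of f' \<in> H)"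


section \<open>Averages\<close>

(* Sequences are indexed by the positive integers; values at 0 are never used. *)

definition Delta :: "(nat \<Rightarrow> real) \<Rightarrow> nat \<Rightarrow> real" where
  "Delta U N = (if N = 1 then U 1 else U N - U (N - 1))"

definition weighted_avg :: "(nat \<Rightarrow> real) \<Rightarrow> (nat \<Rightarrow> complex) \<Rightarrow> nat \<Rightarrow> complex" where
  "weighted_avg W f N = 1 / of_real (W N) * (\<Sum>n=1..N. of_real (Delta W n) * f n)"

(* The normalisation is the length b - a, not the number b - a + 1 of terms. *)
definition interval_avg :: "(nat \<Rightarrow> complex) \<Rightarrow> nat \<Rightarrow> nat \<Rightarrow> complex" where
  "interval_avg f a b = 1 / (of_nat b - of_nat a) * (\<Sum>n=a..b. f n)"

definition twobin_avg :: "(nat \<Rightarrow> complex) \<Rightarrow> nat \<Rightarrow> complex" where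
  "twobin_avg f N = 1 / 2 ^ (N + 1) * (\<Sum>n=1..2 * N. of_nat (N choose (n div 2)) * f n)"


section \<open>Uniform averages along short intervals\<close>

(* The requirement that V tends to infinity is needed: for V(x) = exp(-x) the
   logarithmic ratio tends to 0 while no s satisfies the growth condition, so the
   condition on f would hold vacuously.  The restriction s(N) < N says that the
   interval [N - s(N), N] consists of positive integers. *)
definition short_interval_convergent ::
    "(real \<Rightarrow> real) \<Rightarrow> (nat \<Rightarrow> complex) \<Rightarrow> complex \<Rightarrow> bool" where
  "short_interval_convergent W f l \<longleftrightarrow>
     (\<exists>H V. hardy_field H \<and> germ_of V \<in> H \<and> filterlim V at_top at_top \<and>
        (\<lambda>N::nat. ln (W (real N)) / ln (V (real N))) \<longlonglongrightarrow> 0 \<and>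
        (\<forall>s :: nat \<Rightarrow> nat.
           (\<forall>\<^sub>F N in sequentially. s N < N) \<longrightarrow>
           filterlim (\<lambda>N. real (s N) * Delta (\<lambda>n. ln (V (real n))) N) at_top sequentially \<longrightarrow>
           (\<lambda>N. interval_avg f (N - s N) N) \<longlonglongrightarrow> l))"

end

theory Submission
  imports Defs
begin

text \<open>Both weights live on the scale \<open>sqrt N\<close>. In a Hardy field, \<open>sqrt x = o(ln V)\<close> forces
  \<open>sqrt x * (ln V)'\<close> to tend to infinity, so under (i) the averages over \<open>[N - s, N]\<close> converge
  uniformly for \<open>s \<ge> \<delta> * sqrt N\<close>. As \<open>\<Delta>W\<close> is nondecreasing and \<open>\<Delta>W(N) \<le> W(N) / sqrt N\<close>, the
  \<open>W\<close>-average is a mixture of such interval averages, up to an error \<open>O(\<delta>)\<close> from the shorter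
  ones. Conversely, summation by parts expresses the binomial average as a signed mixture of
  \<open>W\<close>-averages; its total mass is bounded because the binomial weights are unimodal with maximum
  \<open>O(1 / sqrt N)\<close> while \<open>W(n) / \<Delta>W(n) = O(sqrt n)\<close>.\<close>

section \<open>Functions in a Hardy field\<close>

lemma germ_of_eq_iff: "germ_of F = germ_of G \<longleftrightarrow> (\<forall>\<^sub>F x in at_top. F x = G x)"
  by (metis germ.abs_eq_iff germ_eq_def)

text \<open>Membership supplies only some differentiable representative of the germ. Agreement with
  \<open>F\<close> beyond \<open>X\<close> is agreement on an open half-line, so the derivative
  passes to \<open>F\<close> itself.\<close>

lemma hardy_field_deriv:
  assumes "hardy_field H" "germ_of F \<in> H"
  obtains F' where "\<forall>\<^sub>F x in at_top. (F has_real_derivative F' x) (at x)" "germ_of F' \<in> H"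
proof -
  obtain f f' where eq: "germ_of F = germ_of f"
    and d: "\<forall>\<^sub>F x in at_top. (f has_real_derivative f' x) (at x)" and f': "germ_of f' \<in> H"
    using assms unfolding hardy_field_def by metis
  obtain X where X: "\<And>x. x \<ge> X \<Longrightarrow> F x = f x"
    using eq unfolding germ_of_eq_iff eventually_at_top_linorder by blast
  have "\<forall>\<^sub>F x in at_top. (F has_real_derivative f' x) (at x)"
    using d eventually_gt_at_top[of X]
  proof eventually_elim
    case (elim x)
    show ?case
      by (rule has_field_derivative_transform_within_open[OF elim(1), of "{X<..}"])
        (use elim X in auto)
  qed
  with f' show thesis by (rule that[rotated])
qed

lemma hardy_field_inverse:
  assumes "hardy_field H" "germ_of F \<in> H" "germ_of F \<noteq> 0"
  shows "\<forall>\<^sub>F x in at_top. F x \<noteq> 0" "germ_of (\<lambda>x. inverse (F x)) \<in> H"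
proof -
  obtain b where b: "b \<in> H" "germ_of F * b = 1"
    using assms unfolding hardy_field_def by blast
  obtain G where G: "b = germ_of G"
    by (metis Quotient_abs_rep Quotient_germ)
  have ev: "\<forall>\<^sub>F x in at_top. F x * G x = 1"
    using b(2) unfolding G times_germ.abs_eq one_germ_def germ_of_eq_iff .
  then show "\<forall>\<^sub>F x in at_top. F x \<noteq> 0"
    by (rule eventually_mono) auto
  have "germ_of (\<lambda>x. inverse (F x)) = germ_of G"
    unfolding germ_of_eq_iff using ev by (rule eventually_mono) (metis inverse_unique)
  with b G show "germ_of (\<lambda>x. inverse (F x)) \<in> H" by simp
qed

lemma hardy_field_mult:
  "hardy_field H \<Longrightarrow> germ_of F \<in> H \<Longrightarrow> germ_of G \<in> H \<Longrightarrow> germ_of (\<lambda>x. F x * G x) \<in> H"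
  unfolding hardy_field_def by (metis times_germ.abs_eq)

lemma hardy_field_diff:
  assumes "hardy_field H" "germ_of F \<in> H" "germ_of G \<in> H"
  shows "germ_of (\<lambda>x. F x - G x) \<in> H"
proof -
  have "germ_of F + - germ_of G \<in> H"
    using assms unfolding hardy_field_def by blast
  then show ?thesis
    by (simp add: plus_germ.abs_eq uminus_germ.abs_eq)
qed

text \<open>The only real constants guaranteed in \<open>H\<close> are the rationals. These
  reciprocals become arbitrarily small and serve as the thresholds against which derivatives are
  compared.\<close>

lemma hardy_field_inverse_of_nat:
  assumes H: "hardy_field H"
  shows "germ_of (\<lambda>_. inverse (real (Suc k))) \<in> H"
proof (rule hardy_field_inverse(2)[OF H])
  show "germ_of (\<lambda>_. real (Suc k)) \<in> H"
  proof (induction k)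
    case 0
    then show ?case using H by (simp add: hardy_field_def one_germ_def)
  next
    case (Suc k)
    then have "germ_of (\<lambda>_. real (Suc k)) + 1 \<in> H"
      using H by (simp add: hardy_field_def)
    then show ?case by (simp add: plus_germ.abs_eq one_germ_def algebra_simps)
  qed
  show "germ_of (\<lambda>_. real (Suc k)) \<noteq> 0"
    by (simp add: zero_germ_def germ_of_eq_iff del: of_nat_Suc)
qed

text \<open>A nonzero element is invertible, hence eventually without zeros, so the intermediate value
  theorem fixes its sign.\<close>
lemma hardy_field_sign:
  assumes H: "hardy_field H" "germ_of F \<in> H"
  shows "(\<forall>\<^sub>F x in at_top. F x \<le> 0) \<or> (\<forall>\<^sub>F x in at_top. F x > 0)"
proof (cases "germ_of F = 0")
  case True
  then have "\<forall>\<^sub>F x in at_top. F x = 0" by (simp add: zero_germ_def germ_of_eq_iff)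
  then show ?thesis by (auto elim: eventually_mono)
next
  case False
  obtain F' where d: "\<forall>\<^sub>F x in at_top. (F has_real_derivative F' x) (at x)"
    using hardy_field_deriv[OF H] by blast
  from hardy_field_inverse(1)[OF H False] d
  have "\<forall>\<^sub>F x in at_top. F x \<noteq> 0 \<and> isCont F x"
    by eventually_elim (auto intro: DERIV_isCont)
  then obtain X where X: "\<And>x. x \<ge> X \<Longrightarrow> F x \<noteq> 0" "\<And>x. x \<ge> X \<Longrightarrow> isCont F x"
    unfolding eventually_at_top_linorder by blast
  have cont: "continuous_on {X..x} F" for x
    using X(2) by (intro continuous_at_imp_continuous_on) auto
  show ?thesis
  proof (cases "F X > 0")
    case True
    have "F x > 0" if x: "x \<ge> X" for x
    proof (rule ccontr)
      assume "\<not> F x > 0"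
      then obtain z where "z \<ge> X" "F z = 0"
        using IVT2'[of F x 0 X] True x cont[of x] by force
      with X(1) show False by blast
    qed
    then show ?thesis unfolding eventually_at_top_linorder by blast
  next
    case False
    have "F x \<le> 0" if x: "x \<ge> X" for x
    proof (rule ccontr)
      assume "\<not> F x \<le> 0"
      then obtain z where "z \<ge> X" "F z = 0"
        using IVT'[of F X 0 x] False x cont[of x] by force
      with X(1) show False by blast
    qed
    then show ?thesis unfolding eventually_at_top_linorder by blast
  qed
qed

section \<open>Comparison of growth through derivatives\<close>

lemma eventually_le_of_deriv_le:
  fixes F G :: "real \<Rightarrow> real"
  assumes "\<forall>\<^sub>F x in at_top. (F has_real_derivative F' x) (at x)"
    and "\<forall>\<^sub>F x in at_top. (G has_real_derivative G' x) (at x)"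
    and "\<forall>\<^sub>F x in at_top. F' x \<le> G' x"
  obtains C where "\<forall>\<^sub>F x in at_top. F x \<le> G x + C"
proof -
  have "\<forall>\<^sub>F x in at_top. \<exists>y. ((\<lambda>x. F x - G x) has_real_derivative y) (at x) \<and> y \<le> 0"
    using assms
  proof eventually_elim
    case (elim x)
    then show ?case by (intro exI[of _ "F' x - G' x"] conjI DERIV_diff) auto
  qed
  then obtain X where X: "\<And>x. x \<ge> X \<Longrightarrow> \<exists>y. ((\<lambda>x. F x - G x) has_real_derivative y) (at x) \<and> y \<le> 0"
    unfolding eventually_at_top_linorder by blast
  have "F x \<le> G x + (F X - G X)" if "x \<ge> X" for x
    using DERIV_nonpos_imp_nonincreasing[of X x "\<lambda>x. F x - G x"] X that by force
  then show thesis using that unfolding eventually_at_top_linorder by blast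
qed

text \<open>Passing to h = 1 / g^2 turns a bound on \<open>sqrt x * g\<close> into a linear bound on
  \<open>h\<close>, so that comparisons need no square root inside the Hardy field.\<close>

lemma sqrt_lower_from_inverse_square:
  fixes g h x c :: real
  assumes "x > 0" "g > 0" "c > 0" "h = inverse (g * g)" "h \<le> x / c"
  shows "sqrt x * g \<ge> sqrt c"
proof -
  have "c * h \<le> x" using assms by (simp add: field_simps)
  then have "c \<le> x * (g * g)"
    using assms by (simp add: field_simps)
  then have "c \<le> (sqrt x * g)\<^sup>2"
    using assms(1) by (simp add: power_mult_distrib flip: power2_eq_square)
  then show ?thesis using assms by (simp add: real_le_lsqrt)
qed

lemma sqrt_upper_from_inverse_square:
  fixes g h x c :: real
  assumes "x > 0" "g > 0" "c > 0" "h = inverse (g * g)" "h \<ge> x / c"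
  shows "sqrt x * g \<le> sqrt c"
proof -
  have "c * h \<ge> x" using assms by (simp add: field_simps)
  then have "c \<ge> x * (g * g)"
    using assms by (simp add: field_simps)
  then have "c \<ge> (sqrt x * g)\<^sup>2"
    using assms(1) by (simp add: power_mult_distrib flip: power2_eq_square)
  then show ?thesis using real_le_rsqrt by blast
qed

text \<open>The quotient V' / V is in the field, hence eventually of one sign. If it were eventually
  nonpositive, \<open>ln V\<close> would be bounded above, although V tends to infinity.\<close>

lemma hardy_field_log_derivative:
  assumes H: "hardy_field H" and V: "germ_of V \<in> H" and lim: "filterlim V at_top at_top"
  obtains g where "\<forall>\<^sub>F x in at_top. ((\<lambda>x. ln (V x)) has_real_derivative g x) (at x)"
    "germ_of g \<in> H" "\<forall>\<^sub>F x in at_top. g x > 0"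
proof -
  obtain V' where V': "\<forall>\<^sub>F x in at_top. (V has_real_derivative V' x) (at x)" "germ_of V' \<in> H"
    using hardy_field_deriv[OF H V] .
  have pos: "\<forall>\<^sub>F x in at_top. V x > 0"
    using lim by (simp add: filterlim_at_top_dense)
  have "germ_of V \<noteq> 0"
  proof
    assume "germ_of V = 0"
    then have "\<forall>\<^sub>F x in at_top. V x = 0" by (simp add: zero_germ_def germ_of_eq_iff)
    with pos have "\<forall>\<^sub>F x::real in at_top. False" by eventually_elim simp
    then show False by simp
  qed
  note inv = hardy_field_inverse(2)[OF H V this]
  define g where "g = (\<lambda>x. V' x * inverse (V x))"
  have g: "germ_of g \<in> H" unfolding g_def by (rule hardy_field_mult[OF H V'(2) inv])
  have d: "\<forall>\<^sub>F x in at_top. ((\<lambda>x. ln (V x)) has_real_derivative g x) (at x)"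
    using V'(1) pos
    by eventually_elim (auto simp: g_def divide_inverse intro!: derivative_eq_intros)
  have "\<not> (\<forall>\<^sub>F x in at_top. g x \<le> 0)"
  proof
    assume "\<forall>\<^sub>F x in at_top. g x \<le> 0"
    then obtain C where "\<forall>\<^sub>F x in at_top. ln (V x) \<le> 0 + C"
      using eventually_le_of_deriv_le[OF d, of "\<lambda>_. 0" "\<lambda>_. 0"] by auto
    moreover have "\<forall>\<^sub>F x in at_top. V x > exp C"
      using lim by (simp add: filterlim_at_top_dense)
    ultimately have "\<forall>\<^sub>F x::real in at_top. False"
      using pos
    proof eventually_elim
      case (elim x)
      then have "V x \<le> exp C" by (metis add_0 exp_le_cancel_iff exp_ln)
      with elim show ?case by simp
    qed
    then show False by simp
  qed
  then have "\<forall>\<^sub>F x in at_top. g x > 0" using hardy_field_sign[OF H g] by blast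
  with d g show thesis by (rule that)
qed

text \<open>With \<open>g = (ln V)'\<close>, the germ \<open>h = 1 / g\<^sup>2\<close> lies in the Hardy field, so \<open>h'\<close> is comparable
  with every positive rational. If \<open>h' > 1 / (k + 1)\<close> eventually for some \<open>k\<close>, then
  \<open>g = O(1 / sqrt x)\<close> and \<open>ln V = O(sqrt x)\<close>; hence \<open>h = o(x)\<close>. This replaces L'Hopital's
  rule, which would need a Hardy field that also contains \<open>sqrt x\<close>.\<close>
lemma hardy_field_log_derivative_growth:
  assumes H: "hardy_field H" and V: "germ_of V \<in> H" and lim: "filterlim V at_top at_top"
    and slow: "(\<lambda>N::nat. sqrt (real N) / ln (V (real N))) \<longlonglongrightarrow> 0"
    and d: "\<forall>\<^sub>F x in at_top. ((\<lambda>x. ln (V x)) has_real_derivative g x) (at x)"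
    and g: "germ_of g \<in> H" and gpos: "\<forall>\<^sub>F x in at_top. g x > 0"
  shows "\<forall>\<^sub>F x in at_top. sqrt x * g x \<ge> Z"
proof -
  define h where "h = (\<lambda>x. inverse (g x * g x))"
  have "germ_of (\<lambda>x. g x * g x) \<noteq> 0"
  proof
    assume "germ_of (\<lambda>x. g x * g x) = 0"
    then have "\<forall>\<^sub>F x in at_top. g x * g x = 0" by (simp add: zero_germ_def germ_of_eq_iff)
    with gpos have "\<forall>\<^sub>F x::real in at_top. False" by eventually_elim simp
    then show False by simp
  qed
  then have "germ_of h \<in> H"
    unfolding h_def by (rule hardy_field_inverse(2)[OF H hardy_field_mult[OF H g g]])
  then obtain h' where h': "\<forall>\<^sub>F x in at_top. (h has_real_derivative h' x) (at x)" "germ_of h' \<in> H"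
    using hardy_field_deriv[OF H] by blast
  have small: "\<forall>\<^sub>F x in at_top. h' x \<le> inverse (real (Suc k))" for k
  proof (rule ccontr)
    assume contra: "\<not> (\<forall>\<^sub>F x in at_top. h' x \<le> inverse (real (Suc k)))"
    define c where "c = real (Suc k)"
    have c: "c > 0" by (simp add: c_def)
    have "(\<forall>\<^sub>F x in at_top. h' x - inverse c \<le> 0) \<or> (\<forall>\<^sub>F x in at_top. h' x - inverse c > 0)"
      unfolding c_def
      by (rule hardy_field_sign[OF H hardy_field_diff[OF H h'(2) hardy_field_inverse_of_nat[OF H]]])
    with contra have "\<forall>\<^sub>F x in at_top. inverse c \<le> h' x"
      by (auto simp: c_def elim: eventually_mono)
    moreover have "\<forall>\<^sub>F x in at_top. ((\<lambda>x. x / c) has_real_derivative inverse c) (at x)"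
      using c by (intro always_eventually allI) (auto intro!: derivative_eq_intros simp: field_simps)
    ultimately obtain C where "\<forall>\<^sub>F x in at_top. x / c \<le> h x + C"
      using eventually_le_of_deriv_le[of "\<lambda>x. x / c" "\<lambda>_. inverse c", OF _ h'(1)] by blast
    \<comment> \<open>Beyond \<open>2 * c * C\<close> the additive constant is at most half of
      \<open>x / c\<close>, which costs only a factor 2 in the linear lower bound for
      \<open>h\<close>.\<close>
    then have "\<forall>\<^sub>F x in at_top. g x \<le> sqrt (2 * c) / sqrt x"
      using gpos eventually_gt_at_top[of 0] eventually_ge_at_top[of "2 * c * C"]
    proof eventually_elim
      case (elim x)
      have "x / (2 * c) \<ge> C" using elim c by (simp add: field_simps)
      moreover have "x / c = x / (2 * c) + x / (2 * c)" using c by (simp add: field_simps)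
      ultimately have "h x \<ge> x / (2 * c)" using elim by linarith
      then have "sqrt x * g x \<le> sqrt (2 * c)"
        using elim c by (intro sqrt_upper_from_inverse_square[of x "g x" "2 * c" "h x"]) (auto simp: h_def)
      then show ?case using elim by (simp add: field_simps)
    qed
    moreover have "\<forall>\<^sub>F x in at_top.
        ((\<lambda>x. 2 * sqrt (2 * c) * sqrt x) has_real_derivative sqrt (2 * c) / sqrt x) (at x)"
      using eventually_gt_at_top[of 0]
      by eventually_elim (auto intro!: derivative_eq_intros simp: field_simps)
    ultimately obtain C where "\<forall>\<^sub>F x in at_top. ln (V x) \<le> 2 * sqrt (2 * c) * sqrt x + C"
      using eventually_le_of_deriv_le[OF d, of "\<lambda>x. 2 * sqrt (2 * c) * sqrt x"
          "\<lambda>x. sqrt (2 * c) / sqrt x"] by blast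
    then have "\<forall>\<^sub>F N in sequentially. ln (V (real N)) \<le> 2 * sqrt (2 * c) * sqrt (real N) + C"
      using filterlim_real_sequentially unfolding filterlim_iff by blast
    moreover have "\<forall>\<^sub>F N in sequentially. V (real N) > 1"
      using filterlim_compose[OF lim filterlim_real_sequentially] by (simp add: filterlim_at_top_dense)
    \<comment> \<open>The threshold makes \<open>ln V\<close> exceed sqrt N times the sum of
      \<open>2 * sqrt (2 * c)\<close> and the absolute value of C, which for N >= 1 contradicts the
      upper bound just derived.\<close>
    moreover have "\<forall>\<^sub>F N in sequentially. sqrt (real N) / ln (V (real N)) < 1 / (2 * sqrt (2 * c) + \<bar>C\<bar>)"
      using c by (intro order_tendstoD(2)[OF slow]) (auto intro!: add_pos_nonneg)
    ultimately have "\<forall>\<^sub>F N::nat in sequentially. False"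
      using eventually_ge_at_top[of 1]
    proof eventually_elim
      case (elim N)
      have p: "2 * sqrt (2 * c) + \<bar>C\<bar> > 0" using c by (auto intro!: add_pos_nonneg)
      have "ln (V (real N)) > 0" using elim by simp
      then have "sqrt (real N) * (2 * sqrt (2 * c) + \<bar>C\<bar>) < ln (V (real N))"
        using elim(3) p by (simp add: field_simps)
      moreover have "C \<le> sqrt (real N) * \<bar>C\<bar>"
        using elim(4) mult_right_mono[of 1 "sqrt (real N)" "\<bar>C\<bar>"] by simp
      ultimately show ?case using elim(1) by (simp add: algebra_simps)
    qed
    then show False by simp
  qed
  \<comment> \<open>The final estimate is \<open>h x \<le> x / (c / 2)\<close>, so
    \<open>c / 2\<close> has to be at least the square of \<open>Z\<close>.\<close>
  obtain k where k: "real k \<ge> 2 * Z\<^sup>2" using real_arch_simple by blast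
  define c where "c = real (Suc k)"
  have c: "c > 0" "c \<ge> 2 * Z\<^sup>2" using k by (auto simp: c_def)
  have "\<forall>\<^sub>F x in at_top. ((\<lambda>x. x / c) has_real_derivative inverse c) (at x)"
    using c by (intro always_eventually allI) (auto intro!: derivative_eq_intros simp: field_simps)
  then obtain C where "\<forall>\<^sub>F x in at_top. h x \<le> x / c + C"
    using eventually_le_of_deriv_le[OF h'(1), of "\<lambda>x. x / c" "\<lambda>_. inverse c"] small[of k]
    unfolding c_def by blast
  then show ?thesis
    using gpos eventually_gt_at_top[of 0] eventually_ge_at_top[of "c * C"]
  proof eventually_elim
    case (elim x)
    have "C \<le> x / c" using elim c by (simp add: field_simps)
    with elim have "h x \<le> x / c + x / c" by linarith
    also have "\<dots> = x / (c / 2)" using c by (simp add: field_simps)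
    finally have "h x \<le> x / (c / 2)" .
    then have "sqrt x * g x \<ge> sqrt (c / 2)"
      using elim c by (intro sqrt_lower_from_inverse_square[of x "g x" "c / 2" "h x"]) (auto simp: h_def)
    moreover have "Z \<le> sqrt (c / 2)"
      using c by (intro real_le_rsqrt) auto
    ultimately show ?case by simp
  qed
qed

text \<open>By the mean value theorem the increment of \<open>ln V\<close> over [N - 1, N] is g(z)
  for some z < N. Since sqrt z <= sqrt N and g(z) > 0, the growth bound for real arguments passes to
  the integers.\<close>

lemma hardy_field_sqrt_mult_Delta_ln:
  assumes H: "hardy_field H" and V: "germ_of V \<in> H" and lim: "filterlim V at_top at_top"
    and slow: "(\<lambda>N::nat. sqrt (real N) / ln (V (real N))) \<longlonglongrightarrow> 0"
  shows "filterlim (\<lambda>N. sqrt (real N) * Delta (\<lambda>n. ln (V (real n))) N) at_top sequentially"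
proof -
  obtain g where d: "\<forall>\<^sub>F x in at_top. ((\<lambda>x. ln (V x)) has_real_derivative g x) (at x)"
    and g: "germ_of g \<in> H" and gpos: "\<forall>\<^sub>F x in at_top. g x > 0"
    using hardy_field_log_derivative[OF H V lim] .
  show ?thesis
    unfolding filterlim_at_top
  proof
    fix Z :: real
    have "\<forall>\<^sub>F x in at_top. sqrt x * g x \<ge> Z \<and> g x > 0 \<and>
        ((\<lambda>x. ln (V x)) has_real_derivative g x) (at x)"
      using hardy_field_log_derivative_growth[OF H V lim slow d g gpos, of Z] d gpos
      by eventually_elim auto
    then obtain X where X: "\<And>x. x \<ge> X \<Longrightarrow> sqrt x * g x \<ge> Z \<and> g x > 0 \<and>
        ((\<lambda>x. ln (V x)) has_real_derivative g x) (at x)"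
      unfolding eventually_at_top_linorder by blast
    show "\<forall>\<^sub>F N in sequentially. Z \<le> sqrt (real N) * Delta (\<lambda>n. ln (V (real n))) N"
      using eventually_ge_at_top[of "nat \<lceil>X\<rceil> + 2"]
    proof eventually_elim
      case (elim N)
      have N: "real N - 1 \<ge> X" "N \<ge> 2" using elim by linarith+
      obtain z where z: "real N - 1 < z" "z < real N"
        "ln (V (real N)) - ln (V (real N - 1)) = (real N - (real N - 1)) * g z"
        using MVT2[of "real N - 1" "real N" "\<lambda>x. ln (V x)" g] X N by force
      have "Z \<le> sqrt z * g z" and "g z > 0" using X[of z] z N by auto
      moreover have "sqrt z * g z \<le> sqrt (real N) * g z"
        using z \<open>g z > 0\<close> by (intro mult_right_mono) auto
      moreover have "Delta (\<lambda>n. ln (V (real n))) N = g z"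
        using z N by (simp add: Delta_def of_nat_diff)
      ultimately show ?case by (metis order_trans)
    qed
  qed
qed

section \<open>Binomial weights\<close>

text \<open>Induction on the squared inequality: consecutive central coefficients have ratio 2(2m +
  1) / (m + 1), and the step reduces to (2m + 1)(2m + 3) <= 4(m + 1)^2.\<close>

lemma central_binomial_upper_bound: "real ((2 * m) choose m) * sqrt (2 * m + 1) \<le> 4 ^ m"
proof -
  have "(real ((2 * m) choose m))\<^sup>2 * (2 * m + 1) \<le> 16 ^ m"
  proof (induction m)
    case 0
    then show ?case by simp
  next
    case (Suc m)
    have "real (Suc m) * real ((2 * Suc m) choose (Suc m)) = 2 * (2 * m + 1) * real ((2 * m) choose m)"
    proof -
      have "Suc m * ((2 * Suc m) choose (Suc m)) = 2 * Suc m * (Suc (2 * m) choose m)"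
        using Suc_times_binomial_eq[of "Suc (2 * m)" m] by simp
      moreover have "Suc m * (Suc (2 * m) choose m) = (2 * m + 1) * ((2 * m) choose m)"
        using binomial_absorb_comp[of "Suc (2 * m)" m] by (simp add: Suc_diff_le)
      ultimately have "Suc m * ((2 * Suc m) choose (Suc m)) = 2 * (2 * m + 1) * ((2 * m) choose m)"
        by (metis mult.assoc)
      then show ?thesis by (metis of_nat_mult of_nat_numeral)
    qed
    from arg_cong[OF this, of "\<lambda>x. x\<^sup>2"]
    have e: "(real (Suc m))\<^sup>2 * (real ((2 * Suc m) choose (Suc m)))\<^sup>2
        = (real (2 * (2 * m + 1)))\<^sup>2 * (real ((2 * m) choose m))\<^sup>2"
      by (simp only: power_mult_distrib)
    have "(real (Suc m))\<^sup>2 * ((real ((2 * Suc m) choose (Suc m)))\<^sup>2 * (2 * Suc m + 1))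
        = 4 * (2 * m + 1) * (2 * m + 3) * ((real ((2 * m) choose m))\<^sup>2 * (2 * m + 1))"
      unfolding mult.assoc[symmetric] e by (simp add: power2_eq_square algebra_simps)
    also have "\<dots> \<le> real (4 * (2 * m + 1) * (2 * m + 3)) * 16 ^ m"
      using Suc by (intro mult_left_mono) auto
    also have "\<dots> \<le> (real (Suc m))\<^sup>2 * 16 ^ Suc m"
      by (simp add: power2_eq_square algebra_simps)
    finally show ?case by (simp del: power_Suc of_nat_Suc)
  qed
  then have "(real ((2 * m) choose m) * sqrt (2 * m + 1))\<^sup>2 \<le> (4 ^ m)\<^sup>2"
    by (simp add: power_mult_distrib power_mult[symmetric] mult.commute[of m] power_mult[of "4::real" 2])
  then show ?thesis by (rule power2_le_imp_le) simp
qed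

lemma binomial_sqrt_upper_bound: "real (N choose k) * sqrt (real N) \<le> 2 ^ N"
proof -
  have "real (N choose (N div 2)) * sqrt (real N) \<le> 2 ^ N"
  proof (cases "even N")
    case True
    then obtain m where m: "N = 2 * m" by blast
    have "real ((2 * m) choose m) * sqrt (2 * m) \<le> real ((2 * m) choose m) * sqrt (2 * m + 1)"
      by (intro mult_left_mono) auto
    also have "\<dots> \<le> 4 ^ m" by (rule central_binomial_upper_bound)
    finally show ?thesis by (simp add: m power_mult)
  next
    case False
    then obtain m where m: "N = Suc (2 * m)" by (metis oddE Suc_eq_plus1)
    have "(2 * Suc m) choose (Suc m) = 2 * (Suc (2 * m) choose m)"
      using central_binomial_odd[of "Suc (2 * m)"] by simp
    then have "2 * (real (Suc (2 * m) choose m) * sqrt (2 * m + 3)) \<le> 2 * 2 ^ (Suc (2 * m))"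
      using central_binomial_upper_bound[of "Suc m"] power_mult[of "2::real" 2 m]
      by (simp add: algebra_simps)
    moreover have "real (Suc (2 * m) choose m) * sqrt (Suc (2 * m))
        \<le> real (Suc (2 * m) choose m) * sqrt (2 * m + 3)"
      by (intro mult_left_mono) auto
    ultimately have "real (Suc (2 * m) choose m) * sqrt (real (Suc (2 * m))) \<le> 2 ^ Suc (2 * m)"
      by linarith
    moreover have "N div 2 = m" by (simp add: m)
    ultimately show ?thesis by (simp only: m)
  qed
  moreover have "real (N choose k) * sqrt (real N) \<le> real (N choose (N div 2)) * sqrt (real N)"
    by (intro mult_right_mono) (auto simp: binomial_maximum)
  ultimately show ?thesis by linarith
qed

text \<open>The variation telescopes separately on each side of the peak \<open>m\<close>, giving
  \<open>2 * g m - g 0 - g M\<close> once the peak is passed.\<close>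

lemma unimodal_variation:
  fixes g :: "nat \<Rightarrow> real"
  assumes inc: "\<And>n. n < m \<Longrightarrow> g n \<le> g (Suc n)" and dec: "\<And>n. m \<le> n \<Longrightarrow> g (Suc n) \<le> g n"
    and nonneg: "\<And>n. g n \<ge> 0"
  shows "(\<Sum>n<M. \<bar>g n - g (Suc n)\<bar>) \<le> 2 * g m"
proof -
  have "(\<Sum>n<M. \<bar>g n - g (Suc n)\<bar>) = (if M \<le> m then g M - g 0 else 2 * g m - g 0 - g M)"
  proof (induction M)
    case (Suc M)
    consider "Suc M \<le> m" | "M = m" | "M > m" by linarith
    then show ?case
      using Suc inc[of M] dec[of M] by cases (auto simp: abs_if)
  qed simp
  moreover have "g m \<ge> g M" if "M \<le> m"
    using that by (induction rule: inc_induct) (auto intro: order_trans[OF inc])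
  ultimately show ?thesis using nonneg[of 0] nonneg[of M] nonneg[of m] by auto
qed

text \<open>There is no cutoff at 2N: with n = 0 and n = 2N + 1, which the average omits, each
  binomial coefficient occurs exactly twice and the total mass is 1. From 2N + 2 on the weight
  vanishes.\<close>

definition twobin_weight :: "nat \<Rightarrow> nat \<Rightarrow> real" where
  "twobin_weight N n = real (N choose (n div 2)) / 2 ^ (N + 1)"

lemma twobin_weight_nonneg: "twobin_weight N n \<ge> 0"
  by (simp add: twobin_weight_def)

lemma twobin_weight_le: "twobin_weight N n * sqrt (real N) \<le> 1 / 2"
  using binomial_sqrt_upper_bound[of N "n div 2"] by (simp add: twobin_weight_def field_simps)

text \<open>Each coefficient fills the two slots \<open>2 * k\<close> and \<open>2 * k + 1\<close>,
  so the weights stay unimodal with a peak at \<open>2 * (N div 2)\<close>, whose height is O(1 /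
  sqrt N).\<close>

lemma twobin_weight_variation:
  "(\<Sum>n<M. \<bar>twobin_weight N n - twobin_weight N (Suc n)\<bar>) * sqrt (real N) \<le> 1"
proof -
  have "(\<Sum>n<M. \<bar>twobin_weight N n - twobin_weight N (Suc n)\<bar>) \<le> 2 * twobin_weight N (2 * (N div 2))"
  proof (rule unimodal_variation)
    fix n assume "n < 2 * (N div 2)"
    then have "N choose (n div 2) \<le> N choose (Suc n div 2)"
      by (intro binomial_mono) linarith+
    then show "twobin_weight N n \<le> twobin_weight N (Suc n)"
      by (simp add: twobin_weight_def divide_right_mono)
  next
    fix n assume "2 * (N div 2) \<le> n"
    then have "N choose (Suc n div 2) \<le> N choose (n div 2)"
      by (cases "Suc n div 2 \<le> N") (auto intro!: binomial_antimono simp: binomial_eq_0)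
    then show "twobin_weight N (Suc n) \<le> twobin_weight N n"
      by (simp add: twobin_weight_def divide_right_mono)
  qed (rule twobin_weight_nonneg)
  then have "(\<Sum>n<M. \<bar>twobin_weight N n - twobin_weight N (Suc n)\<bar>) * sqrt (real N)
      \<le> 2 * twobin_weight N (2 * (N div 2)) * sqrt (real N)"
    by (intro mult_right_mono) auto
  with twobin_weight_le[of N "2 * (N div 2)"] show ?thesis by linarith
qed

lemma twobin_weight_sum: "(\<Sum>n<2 * N + 2. twobin_weight N n) = 1"
proof -
  have "(\<Sum>n<2 * M. twobin_weight N n) = 2 * (\<Sum>k<M. real (N choose k)) / 2 ^ (N + 1)" for M
    by (induction M) (auto simp: twobin_weight_def field_simps)
  from this[of "Suc N"] have "(\<Sum>n<2 * N + 2. twobin_weight N n) = (\<Sum>k\<le>N. real (N choose k)) / 2 ^ N"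
    by (simp add: lessThan_Suc_atMost)
  also have "(\<Sum>k\<le>N. real (N choose k)) = 2 ^ N"
    by (metis choose_row_sum of_nat_numeral of_nat_power of_nat_sum)
  finally show ?thesis by simp
qed

section \<open>Averages\<close>

text \<open>Toeplitz argument: large indices contribute at most the row bound times a small
  \<open>e\<close>, and the finitely many remaining indices lose their weight column by
  column.\<close>

lemma toeplitz_null:
  fixes w :: "nat \<Rightarrow> nat \<Rightarrow> real" and a :: "nat \<Rightarrow> 'a :: real_normed_vector"
  assumes a: "a \<longlonglongrightarrow> 0" and col: "\<And>n. (\<lambda>N. w N n) \<longlonglongrightarrow> 0"
    and fin: "\<And>N. finite (I N)"
    and bound: "\<forall>\<^sub>F N in sequentially. (\<Sum>n\<in>I N. \<bar>w N n\<bar>) \<le> K"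
  shows "(\<lambda>N. \<Sum>n\<in>I N. w N n *\<^sub>R a n) \<longlonglongrightarrow> 0"
proof (rule tendstoI)
  fix r :: real assume r: "r > 0"
  define e where "e = r / (2 * (\<bar>K\<bar> + 1))"
  have e: "e > 0" using r by (simp add: e_def)
  have "K * e \<le> \<bar>K\<bar> * e" using e by (intro mult_right_mono) auto
  also have "\<dots> < (\<bar>K\<bar> + 1) * e" using e by simp
  also have "\<dots> = r / 2" by (simp add: e_def field_simps)
  finally have Ke: "K * e < r / 2" .
  obtain n0 where n0: "\<And>n. n \<ge> n0 \<Longrightarrow> norm (a n) < e"
    using LIMSEQ_D[OF a e] by auto
  have "(\<lambda>N. \<Sum>n<n0. \<bar>w N n\<bar> * norm (a n)) \<longlonglongrightarrow> (\<Sum>n<n0. \<bar>0\<bar> * norm (a n))"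
    by (intro tendsto_intros col)
  then have "\<forall>\<^sub>F N in sequentially. (\<Sum>n<n0. \<bar>w N n\<bar> * norm (a n)) < r / 2"
    using r by (intro order_tendstoD(2)) auto
  with bound show "\<forall>\<^sub>F N in sequentially. dist (\<Sum>n\<in>I N. w N n *\<^sub>R a n) 0 < r"
  proof eventually_elim
    case (elim N)
    have "norm (\<Sum>n\<in>I N. w N n *\<^sub>R a n) \<le> (\<Sum>n\<in>I N. \<bar>w N n\<bar> * norm (a n))"
      by (rule order_trans[OF norm_sum]) simp
    also have "\<dots> \<le> (\<Sum>n\<in>I N. \<bar>w N n\<bar> * e + (if n \<in> {..<n0} then \<bar>w N n\<bar> * norm (a n) else 0))"
      using n0 e by (intro sum_mono) (auto simp: mult_left_mono less_imp_le not_less)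
    also have "\<dots> = (\<Sum>n\<in>I N. \<bar>w N n\<bar>) * e + (\<Sum>n\<in>I N \<inter> {..<n0}. \<bar>w N n\<bar> * norm (a n))"
      by (simp only: sum.distrib sum_distrib_right sum.inter_restrict[OF fin])
    also have "\<dots> \<le> K * e + (\<Sum>n<n0. \<bar>w N n\<bar> * norm (a n))"
      using e elim by (intro add_mono mult_right_mono sum_mono2) auto
    also have "\<dots> < r" using elim Ke by linarith
    finally show ?case by simp
  qed
qed

lemma sum_Delta: "N \<ge> 1 \<Longrightarrow> (\<Sum>n=1..N. Delta U n) = U N"
  by (induction N rule: nat_induct_at_least) (auto simp: Delta_def)

lemma weighted_avg_diff_const:
  assumes "N \<ge> 1" "U N \<noteq> 0"
  shows "weighted_avg U (\<lambda>n. f n - l) N = weighted_avg U f N - l"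
proof -
  have "(\<Sum>n=1..N. of_real (Delta U n) * (f n - l))
      = (\<Sum>n=1..N. of_real (Delta U n) * f n) - of_real (\<Sum>n=1..N. Delta U n) * l"
    by (simp add: right_diff_distrib sum_subtractf sum_distrib_right)
  then show ?thesis
    unfolding sum_Delta[OF assms(1)] weighted_avg_def
    using assms by (simp add: right_diff_distrib)
qed

text \<open>Since \<open>Delta U n * g n\<close> is the increment of
  \<open>U n * weighted_avg U g n\<close>, Abel summation applies with coefficients
  \<open>b n / Delta U n\<close>. The last summand is the boundary term, which disappears when
  \<open>b (Suc M) = 0\<close>.\<close>

lemma sum_eq_weighted_avg_by_parts:
  assumes U: "\<And>n. n \<ge> 1 \<Longrightarrow> U n \<noteq> 0" and DU: "\<And>n. n \<ge> 1 \<Longrightarrow> Delta U n \<noteq> 0"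
  shows "(\<Sum>n=1..M. of_real (b n) * g n)
    = (\<Sum>n=1..M. (U n * (b n / Delta U n - b (Suc n) / Delta U (Suc n))) *\<^sub>R weighted_avg U g n)
      + (b (Suc M) / Delta U (Suc M)) *\<^sub>R (U M *\<^sub>R weighted_avg U g M)"
proof (induction M)
  case 0
  then show ?case by (simp add: weighted_avg_def)
next
  case (Suc M)
  define c where "c n = b n / Delta U n" for n
  define S where "S = (\<lambda>M. \<Sum>n=1..M. of_real (Delta U n) * g n)"
  have S: "U n *\<^sub>R weighted_avg U g n = S n" for n
    using U[of n] by (cases n) (simp_all add: weighted_avg_def S_def scaleR_conv_of_real)
  have "of_real (b (Suc M)) * g (Suc M) = c (Suc M) *\<^sub>R (S (Suc M) - S M)"
    using DU[of "Suc M"] by (simp add: S_def c_def scaleR_conv_of_real)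
  moreover have w: "(U n * (c n - c (Suc n))) *\<^sub>R weighted_avg U g n = (c n - c (Suc n)) *\<^sub>R S n" for n
    by (metis S mult.commute scaleR_scaleR)
  ultimately show ?case
    using Suc unfolding S c_def[symmetric] w
    by (simp add: algebra_simps)
qed

section \<open>The weight \<open>exp (sqrt x)\<close>\<close>

definition exp_sqrt :: "nat \<Rightarrow> real" where
  "exp_sqrt n = exp (sqrt (real n))"

lemma exp_sqrt_pos: "exp_sqrt n > 0"
  by (simp add: exp_sqrt_def)

lemma Delta_exp_sqrt_pos: "n \<ge> 1 \<Longrightarrow> Delta exp_sqrt n > 0"
  by (simp add: Delta_def exp_sqrt_def)

text \<open>For n >= 2 put t = sqrt n - sqrt (n - 1) and u = 1 / t. The ratio is 1 / (1 - exp (-t)),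
  and 1 + x <= exp x at x = -t and x = t encloses it between u and u + 1. At n = 1 the convention
  for \<open>Delta\<close> makes the ratio 1.\<close>

lemma exp_sqrt_ratio_bounds:
  assumes "n \<ge> 1"
  shows "sqrt (real n) + sqrt (real n - 1) \<le> exp_sqrt n / Delta exp_sqrt n"
    and "exp_sqrt n / Delta exp_sqrt n \<le> sqrt (real n) + sqrt (real n - 1) + 1"
proof -
  have "sqrt (real n) + sqrt (real n - 1) \<le> exp_sqrt n / Delta exp_sqrt n \<and>
    exp_sqrt n / Delta exp_sqrt n \<le> sqrt (real n) + sqrt (real n - 1) + 1"
  proof (cases "n = 1")
    case True
    then show ?thesis by (simp add: Delta_def exp_sqrt_def)
  next
    case False
    define u t where "u = sqrt (real n) + sqrt (real n - 1)" and "t = sqrt (real n) - sqrt (real n - 1)"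
    have tu: "t * u = 1" using assms by (simp add: u_def t_def algebra_simps of_nat_diff)
    have t: "t > 0" using assms by (simp add: t_def)
    have u: "u \<ge> 0" using assms by (simp add: u_def)
    have "exp_sqrt (n - 1) = exp_sqrt n * exp (- t)"
      using assms by (simp add: exp_sqrt_def t_def of_nat_diff flip: exp_add)
    then have D: "Delta exp_sqrt n = exp_sqrt n * (1 - exp (- t))"
      using False by (simp add: Delta_def algebra_simps)
    have r: "exp_sqrt n / Delta exp_sqrt n = 1 / (1 - exp (- t))"
      unfolding D using exp_sqrt_pos[of n] by simp
    have pos: "1 - exp (- t) > 0" using t by simp
    have "1 - exp (- t) \<le> t" using exp_ge_add_one_self[of "- t"] by linarith
    then have "u * (1 - exp (- t)) \<le> 1"
      using mult_left_mono[of "1 - exp (- t)" t u] u tu by (simp add: mult.commute)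
    then have "u \<le> 1 / (1 - exp (- t))" using pos by (simp add: field_simps)
    moreover have "1 / (1 - exp (- t)) \<le> u + 1"
    proof -
      have "exp (- t) * (1 + t) \<le> exp (- t) * exp t"
        by (intro mult_left_mono) auto
      then have "1 + t \<le> (1 - exp (- t)) * (1 + t) + 1"
        by (simp add: algebra_simps flip: exp_add)
      then have "u * t \<le> (1 - exp (- t)) * (u * t + u)"
        using mult_left_mono[of t "(1 - exp (- t)) * (1 + t)" u] u by (simp add: algebra_simps)
      then have "1 \<le> (1 - exp (- t)) * (u + 1)" using tu by (simp add: mult.commute add.commute)
      then show ?thesis using pos by (simp add: field_simps)
    qed
    ultimately show ?thesis by (simp add: r u_def)
  qed
  then show "sqrt (real n) + sqrt (real n - 1) \<le> exp_sqrt n / Delta exp_sqrt n"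
    and "exp_sqrt n / Delta exp_sqrt n \<le> sqrt (real n) + sqrt (real n - 1) + 1" by blast+
qed

lemma sqrt_mult_Delta_exp_sqrt_le:
  assumes "n \<ge> 1"
  shows "Delta exp_sqrt n * sqrt (real n) \<le> exp_sqrt n"
proof -
  have "sqrt (real n) \<le> exp_sqrt n / Delta exp_sqrt n"
    using exp_sqrt_ratio_bounds(1)[OF assms] real_sqrt_ge_zero[of "real n - 1"] assms by linarith
  then show ?thesis using Delta_exp_sqrt_pos[OF assms] by (simp add: field_simps)
qed

text \<open>The mean value theorem on adjacent unit intervals reduces this to monotonicity of the
  derivative \<open>exp (sqrt x) / (2 * sqrt x)\<close> on x >= 1. The index 1 is excluded because
  its increment is \<open>exp 1\<close> by convention.\<close>

lemma Delta_exp_sqrt_mono: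
  assumes "n \<ge> 2"
  shows "Delta exp_sqrt n \<le> Delta exp_sqrt (Suc n)"
proof -
  define d :: "real \<Rightarrow> real" where "d = (\<lambda>x. exp (sqrt x) / (2 * sqrt x))"
  have deriv: "((\<lambda>x. exp (sqrt x)) has_real_derivative d x) (at x)" if "x \<ge> 1" for x :: real
    using that by (auto intro!: derivative_eq_intros simp: d_def field_simps)
  have mono: "d x \<le> d y" if xy: "1 \<le> x" "x \<le> y" for x y
  proof -
    define s t where "s = sqrt y" and "t = sqrt x"
    have st: "1 \<le> t" "t \<le> s" using xy by (auto simp: s_def t_def)
    have "s - t \<le> t * (s - t)" using st mult_right_mono[of 1 t "s - t"] by simp
    then have "s \<le> t * (1 + (s - t))" by (simp add: algebra_simps)
    also have "\<dots> \<le> t * exp (s - t)" using st exp_ge_add_one_self by (intro mult_left_mono) auto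
    finally have "exp t * s \<le> exp t * (t * exp (s - t))" by simp
    also have "\<dots> = exp s * t" by (simp add: exp_diff)
    finally show ?thesis using st by (simp add: d_def field_simps flip: s_def t_def)
  qed
  obtain z1 where z1: "real n - 1 < z1" "z1 < real n"
    "exp (sqrt (real n)) - exp (sqrt (real n - 1)) = (real n - (real n - 1)) * d z1"
    using MVT2[of "real n - 1" "real n" "\<lambda>x. exp (sqrt x)" d] deriv assms by force
  obtain z2 where z2: "real n < z2" "z2 < real n + 1"
    "exp (sqrt (real n + 1)) - exp (sqrt (real n)) = (real n + 1 - real n) * d z2"
    using MVT2[of "real n" "real n + 1" "\<lambda>x. exp (sqrt x)" d] deriv assms by force
  have "d z1 \<le> d z2" using z1 z2 assms by (intro mono) auto
  then show ?thesis
    using assms z1(3) z2(3) by (simp add: Delta_def exp_sqrt_def of_nat_diff add.commute)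
qed

section \<open>From exponential to binomial averages\<close>

lemma exp_sqrt_div_Delta_Suc:
  assumes "n \<ge> 1"
  shows "exp_sqrt n / Delta exp_sqrt (Suc n) = exp_sqrt (Suc n) / Delta exp_sqrt (Suc n) - 1"
proof -
  have "exp_sqrt n = exp_sqrt (Suc n) - Delta exp_sqrt (Suc n)"
    using assms by (simp add: Delta_def)
  then show ?thesis
    using Delta_exp_sqrt_pos[of "Suc n"] by (simp add: diff_divide_distrib)
qed

text \<open>The coefficient of the \<open>n\<close>-th \<open>exp_sqrt\<close>-average in the \<open>N\<close>-th binomial average.\<close>
definition transfer_weight :: "nat \<Rightarrow> nat \<Rightarrow> real" where
  "transfer_weight N n = exp_sqrt n *
    (twobin_weight N n / Delta exp_sqrt n - twobin_weight N (Suc n) / Delta exp_sqrt (Suc n))"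

text \<open>A discrete product rule. With r the ratio of \<open>exp_sqrt\<close> to its increment,
  one part is the variation of the binomial weights times r = O(sqrt n). In the other, r changes by
  O(1) from n to n + 1, leaving a bounded multiple of one binomial weight.\<close>

lemma abs_transfer_weight_le:
  assumes "n \<ge> 1"
  shows "\<bar>transfer_weight N n\<bar> \<le>
    \<bar>twobin_weight N n - twobin_weight N (Suc n)\<bar> * (3 * sqrt (real n)) + 2 * twobin_weight N (Suc n)"
proof -
  define r where "r n = exp_sqrt n / Delta exp_sqrt n" for n
  define b where "b = twobin_weight N"
  have "transfer_weight N n = b n * r n - b (Suc n) * (exp_sqrt n / Delta exp_sqrt (Suc n))"
    by (simp add: transfer_weight_def b_def r_def algebra_simps)
  also have "\<dots> = (b n - b (Suc n)) * r n + b (Suc n) * (1 + r n - r (Suc n))"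
    unfolding exp_sqrt_div_Delta_Suc[OF assms] r_def[symmetric] by (simp add: algebra_simps)
  finally have w: "transfer_weight N n = (b n - b (Suc n)) * r n + b (Suc n) * (1 + r n - r (Suc n))" .
  have sq: "sqrt (real n + 1) \<le> sqrt (real n - 1) + 2" "sqrt (real n - 1) \<le> sqrt (real n)"
    "sqrt (real n) \<ge> 1" "sqrt (real n - 1) \<ge> 0" "sqrt (real n) \<le> sqrt (real n + 1)"
  proof -
    have "sqrt (real n + 1) = sqrt ((real n - 1) + 2)" by (simp add: add.commute)
    also have "\<dots> \<le> sqrt (real n - 1) + sqrt 2" using assms by (intro sqrt_add_le_add_sqrt) auto
    also have "sqrt 2 \<le> (2::real)" by (rule real_le_lsqrt) auto
    finally show "sqrt (real n + 1) \<le> sqrt (real n - 1) + 2" by simp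
  qed (use assms in auto)
  have r: "sqrt (real n) + sqrt (real n - 1) \<le> r n" "r n \<le> sqrt (real n) + sqrt (real n - 1) + 1"
    "sqrt (real n + 1) + sqrt (real n) \<le> r (Suc n)" "r (Suc n) \<le> sqrt (real n + 1) + sqrt (real n) + 1"
    using exp_sqrt_ratio_bounds[OF assms] exp_sqrt_ratio_bounds[of "Suc n"]
    by (auto simp: r_def add.commute)
  \<comment> \<open>The unit windows for \<open>r\<close> place this quantity between d and d + 2,
    where d = sqrt (n - 1) - sqrt (n + 1) lies between -2 and 0.\<close>
  have "\<bar>1 + r n - r (Suc n)\<bar> \<le> 2" and "0 \<le> r n" "r n \<le> 3 * sqrt (real n)"
    using r sq by linarith+
  then have "\<bar>(b n - b (Suc n)) * r n\<bar> \<le> \<bar>b n - b (Suc n)\<bar> * (3 * sqrt (real n))"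
    and "\<bar>b (Suc n) * (1 + r n - r (Suc n))\<bar> \<le> b (Suc n) * 2"
    unfolding abs_mult using twobin_weight_nonneg by (auto intro!: mult_mono simp: b_def)
  then show ?thesis unfolding w b_def[symmetric] by linarith
qed

text \<open>On this range sqrt n <= 2 sqrt N, so the O(1 / sqrt N) variation of the weights absorbs
  the factor sqrt n and gives 6; the total mass 1 gives the remaining 2.\<close>

lemma sum_abs_transfer_weight_le:
  assumes "N \<ge> 1"
  shows "(\<Sum>n=1..2 * N + 1. \<bar>transfer_weight N n\<bar>) \<le> 8"
proof -
  have sub: "{1..2 * N + 1} \<subseteq> {..<2 * N + 2}" by auto
  have "(\<Sum>n=1..2 * N + 1. \<bar>transfer_weight N n\<bar>)
    \<le> (\<Sum>n=1..2 * N + 1. \<bar>twobin_weight N n - twobin_weight N (Suc n)\<bar> * (6 * sqrt (real N))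
        + 2 * twobin_weight N (Suc n))"
  proof (rule sum_mono)
    fix n assume n: "n \<in> {1..2 * N + 1}"
    have "sqrt (real n) \<le> sqrt (4 * real N)" using n assms by (intro real_sqrt_le_mono) auto
    then have "3 * sqrt (real n) \<le> 6 * sqrt (real N)" by (simp add: real_sqrt_mult)
    then have "\<bar>twobin_weight N n - twobin_weight N (Suc n)\<bar> * (3 * sqrt (real n))
        \<le> \<bar>twobin_weight N n - twobin_weight N (Suc n)\<bar> * (6 * sqrt (real N))"
      by (intro mult_left_mono) auto
    moreover have "n \<ge> 1" using n by simp
    ultimately show "\<bar>transfer_weight N n\<bar> \<le> \<bar>twobin_weight N n - twobin_weight N (Suc n)\<bar> * (6 * sqrt (real N))
        + 2 * twobin_weight N (Suc n)"
      using abs_transfer_weight_le[of n N] by linarith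
  qed
  also have "\<dots> \<le> (\<Sum>n<2 * N + 2. \<bar>twobin_weight N n - twobin_weight N (Suc n)\<bar> * (6 * sqrt (real N))
        + 2 * twobin_weight N (Suc n))"
    using sub by (intro sum_mono2) (auto intro!: add_nonneg_nonneg simp: twobin_weight_nonneg)
  also have "\<dots> = 6 * ((\<Sum>n<2 * N + 2. \<bar>twobin_weight N n - twobin_weight N (Suc n)\<bar>) * sqrt (real N))
        + 2 * (\<Sum>n<2 * N + 2. twobin_weight N (Suc n))"
    by (simp only: sum.distrib sum_distrib_left sum_distrib_right mult_ac)
  also have "\<dots> \<le> 6 * 1 + 2 * 1"
  proof -
    \<comment> \<open>The shift drops the weight at 0 and adds the one at 2N + 2, which is
      zero.\<close>
    have "(\<Sum>n<2 * N + 2. twobin_weight N (Suc n)) \<le> (\<Sum>n<Suc (2 * N + 2). twobin_weight N n)"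
      unfolding sum.lessThan_Suc_shift using twobin_weight_nonneg[of N 0] by simp
    also have "\<dots> = 1"
      unfolding sum.lessThan_Suc twobin_weight_sum by (simp add: twobin_weight_def)
    finally show ?thesis
      using twobin_weight_variation[of N "2 * N + 2"] by linarith
  qed
  finally show ?thesis by simp
qed

lemma twobin_weight_tendsto_0: "(\<lambda>N. twobin_weight N n) \<longlonglongrightarrow> 0"
proof (rule real_tendsto_sandwich)
  show "\<forall>\<^sub>F N in sequentially. 0 \<le> twobin_weight N n"
    by (simp add: twobin_weight_nonneg)
  show "\<forall>\<^sub>F N in sequentially. twobin_weight N n \<le> (1 / 2) * inverse (sqrt (real N))"
    using eventually_gt_at_top[of 0]
  proof eventually_elim
    case (elim N)
    then show ?case using twobin_weight_le[of N n] by (simp add: field_simps)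
  qed
  have "(\<lambda>N. inverse (sqrt (real N))) \<longlonglongrightarrow> 0"
    by (intro tendsto_inverse_0_at_top filterlim_compose[OF sqrt_at_top filterlim_real_sequentially])
  then show "(\<lambda>N. (1 / 2) * inverse (sqrt (real N))) \<longlonglongrightarrow> 0"
    using tendsto_mult_right_zero by blast
qed simp

text \<open>After subtracting the limit, the binomial sum is a Toeplitz transform of the null
  sequence of \<open>exp_sqrt\<close>-averages: \<open>transfer_weight\<close> has vanishing columns
  and rows of bounded mass.\<close>

lemma twobin_avg_tendsto:
  assumes f: "bounded (f ` {1..})" and lim: "(\<lambda>N. weighted_avg exp_sqrt f N) \<longlonglongrightarrow> l"
  shows "(\<lambda>N. twobin_avg f N) \<longlonglongrightarrow> l"
proof -
  define g where "g = (\<lambda>n. f n - l)"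
  \<comment> \<open>Summing up to 2N + 1 rather than 2N makes the boundary term of the summation by
    parts vanish, because \<open>twobin_weight N (2 * N + 2) = 0\<close>.\<close>
  define X where "X = (\<lambda>N. \<Sum>n=1..2 * N + 1. of_real (twobin_weight N n) * g n)"
  have "(\<lambda>N. weighted_avg exp_sqrt f N - l) \<longlonglongrightarrow> l - l"
    by (intro tendsto_intros lim)
  moreover have "\<forall>\<^sub>F N in sequentially. weighted_avg exp_sqrt f N - l = weighted_avg exp_sqrt g N"
    using eventually_ge_at_top[of 1]
  proof eventually_elim
    case (elim N)
    then show ?case
      using exp_sqrt_pos[of N] weighted_avg_diff_const[of N exp_sqrt f l] by (simp add: g_def)
  qed
  ultimately have g: "(\<lambda>N. weighted_avg exp_sqrt g N) \<longlonglongrightarrow> 0"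
    by (auto intro: Lim_transform_eventually)
  have "exp_sqrt n \<noteq> 0" "n \<ge> 1 \<Longrightarrow> Delta exp_sqrt n \<noteq> 0" for n
    using exp_sqrt_pos[of n] Delta_exp_sqrt_pos[of n] by auto
  then have "X N = (\<Sum>n=1..2 * N + 1. transfer_weight N n *\<^sub>R weighted_avg exp_sqrt g n)" for N
    unfolding X_def transfer_weight_def
    by (subst sum_eq_weighted_avg_by_parts[of exp_sqrt]) (auto simp: twobin_weight_def)
  then have "X = (\<lambda>N. \<Sum>n=1..2 * N + 1. transfer_weight N n *\<^sub>R weighted_avg exp_sqrt g n)"
    by (rule ext)
  moreover have "(\<lambda>N. \<Sum>n=1..2 * N + 1. transfer_weight N n *\<^sub>R weighted_avg exp_sqrt g n) \<longlonglongrightarrow> 0"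
  proof (rule toeplitz_null[OF g])
    fix n
    have "(\<lambda>N. transfer_weight N n) \<longlonglongrightarrow> exp_sqrt n * (0 / Delta exp_sqrt n - 0 / Delta exp_sqrt (Suc n))"
      unfolding transfer_weight_def divide_inverse by (intro tendsto_intros twobin_weight_tendsto_0)
    then show "(\<lambda>N. transfer_weight N n) \<longlonglongrightarrow> 0" by simp
    show "\<forall>\<^sub>F N in sequentially. (\<Sum>n=1..2 * N + 1. \<bar>transfer_weight N n\<bar>) \<le> 8"
      using eventually_ge_at_top[of 1] by eventually_elim (rule sum_abs_transfer_weight_le)
  qed auto
  ultimately have X: "X \<longlonglongrightarrow> 0" by (simp only:)
  obtain B where B: "\<And>n. n \<ge> 1 \<Longrightarrow> norm (f n) \<le> B"
    using f unfolding bounded_iff by auto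
  have p: "(\<lambda>N. inverse (2 ^ (N + 1)) :: real) \<longlonglongrightarrow> 0"
    using LIMSEQ_Suc[OF LIMSEQ_inverse_realpow_zero[of 2]] by simp
  \<comment> \<open>Two exponentially small corrections: the range of \<open>X\<close> misses the
    mass at n = 0, and \<open>X\<close> contains the term n = 2N + 1 absent from
    \<open>twobin_avg\<close>.\<close>
  have split: "twobin_avg f N = X N + of_real (1 - inverse (2 ^ (N + 1))) * l
      - of_real (inverse (2 ^ (N + 1))) * f (2 * N + 1)" for N
  proof -
    define b where "b n = complex_of_real (twobin_weight N n)" for n
    have s: "{..<2 * N + 2} = insert 0 {1..2 * N + 1}" by auto
    have "(\<Sum>n=1..2 * N + 1. twobin_weight N n) = 1 - inverse (2 ^ (N + 1))"
    proof -
      have "(\<Sum>n<2 * N + 2. twobin_weight N n) = twobin_weight N 0 + (\<Sum>n=1..2 * N + 1. twobin_weight N n)"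
        unfolding s by (rule sum.insert) auto
      moreover have "twobin_weight N 0 = inverse (2 ^ (N + 1))"
        by (simp add: twobin_weight_def inverse_eq_divide)
      ultimately show ?thesis using twobin_weight_sum[of N] by linarith
    qed
    then have 1: "(\<Sum>n=1..2 * N + 1. b n) = of_real (1 - inverse (2 ^ (N + 1)))"
      unfolding b_def by (simp only: flip: of_real_sum)
    have "X N = (\<Sum>n=1..2 * N + 1. b n * f n) - (\<Sum>n=1..2 * N + 1. b n) * l"
      by (simp add: X_def g_def b_def right_diff_distrib sum_subtractf sum_distrib_right del: sum.cl_ivl_Suc)
    moreover have "(\<Sum>n=1..2 * N + 1. b n * f n)
        = (\<Sum>n=1..2 * N. b n * f n) + of_real (inverse (2 ^ (N + 1))) * f (2 * N + 1)"
      by (simp add: b_def twobin_weight_def inverse_eq_divide)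
    moreover have "twobin_avg f N = (\<Sum>n=1..2 * N. b n * f n)"
      by (simp add: twobin_avg_def b_def twobin_weight_def sum_distrib_left)
    ultimately show ?thesis by (simp only: 1 diff_add_cancel add_diff_cancel_right')
  qed
  have "(\<lambda>N. of_real (inverse (2 ^ (N + 1))) * f (2 * N + 1)) \<longlonglongrightarrow> 0"
  proof (rule Lim_null_comparison)
    show "\<forall>\<^sub>F N in sequentially. norm (of_real (inverse (2 ^ (N + 1))) * f (2 * N + 1))
        \<le> inverse (2 ^ (N + 1)) * B"
      using B by (intro always_eventually allI) (simp add: norm_mult norm_inverse norm_power mult_left_mono)
    show "(\<lambda>N. inverse (2 ^ (N + 1)) * B) \<longlonglongrightarrow> 0"
      using tendsto_mult_right[OF p, of B] by simp
  qed
  moreover have "(\<lambda>N. of_real (1 - inverse (2 ^ (N + 1))) * l) \<longlonglongrightarrow> of_real (1 - 0) * l"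
    by (intro tendsto_intros p)
  ultimately have "(\<lambda>N. X N + of_real (1 - inverse (2 ^ (N + 1))) * l
      - of_real (inverse (2 ^ (N + 1))) * f (2 * N + 1)) \<longlonglongrightarrow> 0 + of_real (1 - 0) * l - 0"
    by (intro tendsto_diff tendsto_add X)
  then show ?thesis unfolding split by simp
qed

section \<open>From short intervals to exponential averages\<close>

text \<open>Makes N - 1 a legitimate fallback length in the selection argument below.\<close>

lemma eventually_mult_sqrt_le: "\<forall>\<^sub>F N in sequentially. \<delta> * sqrt (real N) \<le> real N - 1"
  using eventually_ge_at_top[of 2] eventually_ge_at_top[of "nat \<lceil>(2 * \<delta>)\<^sup>2\<rceil>"]
proof eventually_elim
  case (elim N)
  have "2 * \<delta> \<le> sqrt (real N)" using elim by (intro real_le_rsqrt) linarith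
  then have "2 * \<delta> * sqrt (real N) \<le> sqrt (real N) * sqrt (real N)"
    by (intro mult_right_mono) auto
  also have "\<dots> = real N" by simp
  finally show ?case using elim by simp
qed

text \<open>A violation of uniformity in \<open>s\<close> for infinitely many \<open>N\<close> would give a single admissible
  sequence along which the averages do not converge.\<close>
lemma short_interval_convergent_uniform:
  assumes conv: "short_interval_convergent (\<lambda>x. exp (sqrt x)) f l" and "\<epsilon> > 0" "\<delta> > 0"
  shows "\<forall>\<^sub>F N in sequentially. \<forall>s<N. \<delta> * sqrt (real N) \<le> real s \<longrightarrow>
    norm (interval_avg f (N - s) N - l) < \<epsilon>"
proof -
  obtain H V where HV: "hardy_field H" "germ_of V \<in> H" "filterlim V at_top at_top"
    "(\<lambda>N::nat. sqrt (real N) / ln (V (real N))) \<longlonglongrightarrow> 0"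
    and s_conv: "\<And>s. \<forall>\<^sub>F N in sequentially. s N < N \<Longrightarrow>
      filterlim (\<lambda>N. real (s N) * Delta (\<lambda>n. ln (V (real n))) N) at_top sequentially \<Longrightarrow>
      (\<lambda>N. interval_avg f (N - s N) N) \<longlonglongrightarrow> l"
    using conv unfolding short_interval_convergent_def by auto
  define \<Delta> where "\<Delta> = Delta (\<lambda>n. ln (V (real n)))"
  have growth: "filterlim (\<lambda>N. sqrt (real N) * \<Delta> N) at_top sequentially"
    unfolding \<Delta>_def by (rule hardy_field_sqrt_mult_Delta_ln[OF HV])
  define P where "P N s \<longleftrightarrow> s < N \<and> \<delta> * sqrt (real N) \<le> real s \<and>
    \<not> norm (interval_avg f (N - s) N - l) < \<epsilon>" for N s
  \<comment> \<open>A counterexample is selected wherever one exists; elsewhere the full length N -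
    1 keeps the sequence admissible for large N.\<close>
  define s where "s = (\<lambda>N. if \<exists>s. P N s then SOME s. P N s else N - 1)"
  have sP: "P N (s N)" if "P N k" for N k
    using that someI[of "P N" k] by (auto simp: s_def)
  have s: "s N < N \<and> \<delta> * sqrt (real N) \<le> real (s N)" if "N \<ge> 1" "\<delta> * sqrt (real N) \<le> real N - 1" for N
  proof (cases "\<exists>k. P N k")
    case True
    then show ?thesis using sP unfolding P_def by blast
  next
    case False
    then have "s N = N - 1" by (simp only: s_def if_False)
    with that show ?thesis by (simp add: of_nat_diff)
  qed
  have "\<forall>\<^sub>F N in sequentially. s N < N"
    using eventually_ge_at_top[of 1] eventually_mult_sqrt_le[of \<delta>] by eventually_elim (use s in blast)
  moreover have "filterlim (\<lambda>N. real (s N) * \<Delta> N) at_top sequentially"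
  proof (rule filterlim_at_top_mono)
    show "filterlim (\<lambda>N. \<delta> * (sqrt (real N) * \<Delta> N)) at_top sequentially"
      using \<open>\<delta> > 0\<close> by (intro filterlim_tendsto_pos_mult_at_top[OF tendsto_const _ growth])
    have "\<forall>\<^sub>F N in sequentially. sqrt (real N) * \<Delta> N > 0"
      using growth by (simp add: filterlim_at_top_dense)
    then show "\<forall>\<^sub>F N in sequentially. \<delta> * (sqrt (real N) * \<Delta> N) \<le> real (s N) * \<Delta> N"
      using eventually_ge_at_top[of 1] eventually_mult_sqrt_le[of \<delta>]
    proof eventually_elim
      case (elim N)
      then have "\<Delta> N \<ge> 0" by (simp add: zero_less_mult_iff)
      then have "\<delta> * sqrt (real N) * \<Delta> N \<le> real (s N) * \<Delta> N"
        using s elim by (intro mult_right_mono) auto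
      then show ?case by (simp add: mult.assoc)
    qed
  qed
  ultimately have "(\<lambda>N. interval_avg f (N - s N) N) \<longlonglongrightarrow> l"
    using s_conv unfolding \<Delta>_def by blast
  then have "\<forall>\<^sub>F N in sequentially. norm (interval_avg f (N - s N) N - l) < \<epsilon>"
    using \<open>\<epsilon> > 0\<close> by (auto simp: tendsto_iff dist_norm)
  then show ?thesis
    by eventually_elim (use sP in \<open>auto simp: P_def\<close>)
qed

text \<open>Each \<open>D n\<close> is the telescoping sum of the increments up to n, and exchanging
  the summations gathers the tails. For nondecreasing \<open>D\<close> this is a nonnegative mixture
  of final segments.\<close>

lemma sum_scaleR_eq_sum_tails:
  fixes g :: "nat \<Rightarrow> 'a :: real_vector"
  assumes "D 0 = 0"
  shows "(\<Sum>n=1..N. D n *\<^sub>R g n) = (\<Sum>m=1..N. (D m - D (m - 1)) *\<^sub>R (\<Sum>n=m..N. g n))"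
proof (induction N)
  case (Suc N)
  have tele: "(\<Sum>m=1..M. D m - D (m - 1)) = D M" for M
    by (induction M) (auto simp: assms)
  have "(\<Sum>m=1..Suc N. (D m - D (m - 1)) *\<^sub>R (\<Sum>n=m..Suc N. g n))
      = (\<Sum>m=1..Suc N. (D m - D (m - 1)) *\<^sub>R (\<Sum>n=m..N. g n) + (D m - D (m - 1)) *\<^sub>R g (Suc N))"
    by (intro sum.cong) (auto simp: scaleR_add_right)
  also have "\<dots> = (\<Sum>m=1..N. (D m - D (m - 1)) *\<^sub>R (\<Sum>n=m..N. g n)) + D (Suc N) *\<^sub>R g (Suc N)"
    using tele[of "Suc N"] by (simp add: sum.distrib flip: scaleR_sum_left scaleR_add_left)
  finally show ?case using Suc by simp
qed simp

text \<open>Monotonicity makes the coefficients of the tail decomposition nonnegative, so the tail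
  bounds simply add up. The same identity for the constant sequence 1 evaluates the factor of
  \<epsilon>, and the additive errors telescope to \<open>K * D N\<close>.\<close>

lemma norm_sum_scaleR_le:
  fixes g :: "nat \<Rightarrow> 'a :: real_normed_vector"
  assumes D0: "D 0 = 0" and mono: "\<And>n. D n \<le> D (Suc n)"
    and tail: "\<And>m. 1 \<le> m \<Longrightarrow> m \<le> N \<Longrightarrow> norm (\<Sum>n=m..N. g n) \<le> \<epsilon> * real (N + 1 - m) + K"
  shows "norm (\<Sum>n=1..N. D n *\<^sub>R g n) \<le> \<epsilon> * (\<Sum>n=1..N. D n) + K * D N"
proof -
  have nonneg: "D m - D (m - 1) \<ge> 0" for m
    using mono[of "m - 1"] by (cases m) auto
  have "norm (\<Sum>n=1..N. D n *\<^sub>R g n) \<le> (\<Sum>m=1..N. (D m - D (m - 1)) * (\<epsilon> * real (N + 1 - m) + K))"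
    unfolding sum_scaleR_eq_sum_tails[of D, OF D0]
    using tail nonneg by (intro sum_norm_le) (auto intro!: mult_left_mono)
  also have "\<dots> = \<epsilon> * (\<Sum>m=1..N. (D m - D (m - 1)) * real (N + 1 - m)) + K * (\<Sum>m=1..N. D m - D (m - 1))"
    by (simp add: sum_distrib_left algebra_simps flip: sum.distrib)
  also have "(\<Sum>m=1..N. (D m - D (m - 1)) * real (N + 1 - m)) = (\<Sum>n=1..N. D n)"
    using sum_scaleR_eq_sum_tails[of D "\<lambda>_. 1::real" N, OF D0] by simp
  also have "(\<Sum>m=1..N. D m - D (m - 1)) = D N"
    by (induction N) (auto simp: D0)
  finally show ?thesis .
qed

text \<open>The tail error \<open>K\<close> meets only the last weight, which is at most
  \<open>exp_sqrt N / sqrt N\<close>. A \<open>K\<close> of order \<delta> sqrt N therefore costs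
  only O(\<delta>) after normalisation.\<close>

lemma norm_weighted_avg_exp_sqrt_le:
  assumes N: "N \<ge> 2" and B: "\<And>n. n \<ge> 1 \<Longrightarrow> norm (g n) \<le> B"
    and "\<epsilon> \<ge> 0" "K \<ge> 0"
    and tail: "\<And>m. 1 \<le> m \<Longrightarrow> m \<le> N \<Longrightarrow> norm (\<Sum>n=m..N. g n) \<le> \<epsilon> * real (N + 1 - m) + K"
  shows "norm (weighted_avg exp_sqrt g N) \<le> \<epsilon> + (exp 1 * B + K) / sqrt (real N)"
proof -
  \<comment> \<open>\<open>Delta exp_sqrt 1 = exp 1\<close> exceeds \<open>Delta exp_sqrt 2\<close>, so the first term is split off to get
    monotone weights.\<close>
  define D where "D n = (if n \<le> 1 then 0 else Delta exp_sqrt n)" for n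
  have D: "D n \<le> D (Suc n)" for n
    using Delta_exp_sqrt_mono[of n] Delta_exp_sqrt_pos[of "Suc n"] by (auto simp: D_def)
  have split: "(\<Sum>n=1..N. of_real (Delta exp_sqrt n) * g n) = exp 1 *\<^sub>R g 1 + (\<Sum>n=1..N. D n *\<^sub>R g n)"
    using N
    by (simp add: sum.atLeast_Suc_atMost D_def scaleR_conv_of_real Delta_def exp_sqrt_def cong: sum.cong_simp)
  have sumD: "(\<Sum>n=1..N. D n) \<le> exp_sqrt N"
  proof -
    have "(\<Sum>n=1..N. D n) \<le> (\<Sum>n=1..N. Delta exp_sqrt n)"
      using Delta_exp_sqrt_pos by (intro sum_mono) (auto simp: D_def less_imp_le)
    also have "\<dots> = exp_sqrt N" using N by (intro sum_Delta) simp
    finally show ?thesis .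
  qed
  have "norm (\<Sum>n=1..N. of_real (Delta exp_sqrt n) * g n)
      \<le> exp 1 * B + (\<epsilon> * (\<Sum>n=1..N. D n) + K * D N)"
    unfolding split
    using B[of 1] norm_sum_scaleR_le[of D N g \<epsilon> K, OF _ D tail]
    by (intro order_trans[OF norm_triangle_ineq] add_mono) (auto simp: D_def)
  also have "\<dots> \<le> exp 1 * B + (\<epsilon> * exp_sqrt N + K * (exp_sqrt N / sqrt (real N)))"
    using sumD sqrt_mult_Delta_exp_sqrt_le[of N] N \<open>\<epsilon> \<ge> 0\<close> \<open>K \<ge> 0\<close>
    by (intro add_mono mult_left_mono) (auto simp: D_def field_simps)
  \<comment> \<open>The split-off first term is put over the common factor, which is at least 1
    because sqrt N <= exp (sqrt N).\<close>
  also have "\<dots> \<le> exp 1 * B * (exp_sqrt N / sqrt (real N)) + (\<epsilon> * exp_sqrt N + K * (exp_sqrt N / sqrt (real N)))"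
  proof -
    have "sqrt (real N) \<le> exp_sqrt N"
      unfolding exp_sqrt_def using exp_ge_add_one_self[of "sqrt (real N)"] by linarith
    then have "1 \<le> exp_sqrt N / sqrt (real N)" using N by (simp add: field_simps)
    moreover have "B \<ge> 0" using order_trans[OF norm_ge_zero B[of 1]] by simp
    ultimately have "exp 1 * B * 1 \<le> exp 1 * B * (exp_sqrt N / sqrt (real N))"
      by (intro mult_left_mono) auto
    then show ?thesis by simp
  qed
  also have "\<dots> = exp_sqrt N * (\<epsilon> + (exp 1 * B + K) / sqrt (real N))"
    by (simp add: algebra_simps add_divide_distrib)
  finally show ?thesis
    using exp_sqrt_pos[of N] by (simp add: weighted_avg_def norm_mult norm_divide field_simps)
qed

lemma weighted_avg_exp_sqrt_tendsto:
  assumes f: "bounded (f ` {1..})" and conv: "short_interval_convergent (\<lambda>x. exp (sqrt x)) f l"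
  shows "(\<lambda>N. weighted_avg exp_sqrt f N) \<longlonglongrightarrow> l"
proof (rule tendstoI)
  fix r :: real assume r: "r > 0"
  define g where "g = (\<lambda>n. f n - l)"
  obtain B0 where B0: "\<And>n. n \<ge> 1 \<Longrightarrow> norm (f n) \<le> B0"
    using f unfolding bounded_iff by auto
  define B where "B = B0 + norm l"
  have B: "norm (g n) \<le> B" if "n \<ge> 1" for n
    unfolding g_def B_def using B0[OF that] norm_triangle_ineq4[of "f n" l] by linarith
  have B_nonneg: "B \<ge> 0" using order_trans[OF norm_ge_zero B[of 1]] by simp
  \<comment> \<open>The final error terms are \<epsilon>, \<open>B * \<delta>\<close> and C / sqrt
    N, each made at most r / 4; the 1 in the denominator allows B = 0.\<close>
  define \<epsilon> \<delta> where "\<epsilon> = r / 4" and "\<delta> = r / (4 * (B + 1))"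
  have \<epsilon>: "\<epsilon> > 0" and \<delta>: "\<delta> > 0" "B * \<delta> \<le> r / 4"
    using r B_nonneg by (auto simp: \<epsilon>_def \<delta>_def field_simps)
  define C where "C = exp 1 * B + norm l + B"
  have "(\<lambda>N. C * inverse (sqrt (real N))) \<longlonglongrightarrow> C * 0"
    by (intro tendsto_mult tendsto_const tendsto_inverse_0_at_top
        filterlim_compose[OF sqrt_at_top filterlim_real_sequentially])
  then have "\<forall>\<^sub>F N in sequentially. C * inverse (sqrt (real N)) < r / 4"
    using r by (intro order_tendstoD(2)) auto
  with short_interval_convergent_uniform[OF conv \<epsilon> \<delta>(1)] eventually_ge_at_top[of 2]
  show "\<forall>\<^sub>F N in sequentially. dist (weighted_avg exp_sqrt f N) l < r"
  proof eventually_elim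
    case (elim N)
    \<comment> \<open>One constant for both kinds of tail: \<open>norm l\<close> pays for the extra
      term of a long tail, and the rest is the trivial bound for a tail with fewer than \<delta>
      sqrt N + 1 terms.\<close>
    define K where "K = norm l + B * (\<delta> * sqrt (real N) + 1)"
    have K: "K \<ge> 0" using B_nonneg \<delta> by (simp add: K_def)
    have tail: "norm (\<Sum>n=m..N. g n) \<le> \<epsilon> * real (N + 1 - m) + K" if m: "1 \<le> m" "m \<le> N" for m
    proof (cases "\<delta> * sqrt (real N) \<le> real (N - m)")
      case True
      define s where "s = N - m"
      have s: "N - s = m" "s < N" "real s = real N - real m" using m by (auto simp: s_def)
      have "0 < \<delta> * sqrt (real N)" using \<delta> elim by simp
      with True have "real s > 0" unfolding s_def by linarith
      have avg: "norm (interval_avg f m N - l) < \<epsilon>"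
        using elim(1) s True unfolding s_def by auto
      have "complex_of_real (real s) = of_nat N - of_nat m"
        using s(3) by simp
      then have "(\<Sum>n=m..N. f n) = of_real (real s) * interval_avg f m N"
        using \<open>real s > 0\<close> unfolding interval_avg_def
        by (simp flip: \<open>complex_of_real (real s) = of_nat N - of_nat m\<close>)
      \<comment> \<open>Off by one: the segment from m to N has s + 1 terms while
        \<open>interval_avg\<close> divides by s, whence the extra \<open>l\<close>.\<close>
      moreover have "(\<Sum>n=m..N. g n) = (\<Sum>n=m..N. f n) - (of_real (real s) + 1) * l"
        using m by (simp add: g_def sum_subtractf s_def Suc_diff_le)
      ultimately have "(\<Sum>n=m..N. g n) = of_real (real s) * (interval_avg f m N - l) - l"
        by (simp add: algebra_simps)
      then have "norm (\<Sum>n=m..N. g n) \<le> real s * norm (interval_avg f m N - l) + norm l"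
        using norm_triangle_ineq4[of "of_real (real s) * (interval_avg f m N - l)" l]
        by (simp add: norm_mult)
      also have "\<dots> \<le> real s * \<epsilon> + norm l"
        using avg by (intro add_mono mult_left_mono) auto
      also have "\<dots> \<le> \<epsilon> * real (N + 1 - m) + K"
        using m \<epsilon> \<delta> B_nonneg by (simp add: K_def s_def of_nat_diff algebra_simps)
      finally show ?thesis .
    next
      case False
      have "norm (\<Sum>n=m..N. g n) \<le> real (card {m..N}) * B"
        using B m by (intro sum_norm_bound) auto
      also have "real (card {m..N}) = real (N - m) + 1" using m by (simp add: Suc_diff_le)
      also have "(real (N - m) + 1) * B \<le> (\<delta> * sqrt (real N) + 1) * B"
        using False B_nonneg by (intro mult_right_mono) auto
      also have "\<dots> \<le> \<epsilon> * real (N + 1 - m) + K" using \<epsilon> by (simp add: K_def mult.commute)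
      finally show ?thesis .
    qed
    have "norm (weighted_avg exp_sqrt g N) \<le> \<epsilon> + (exp 1 * B + K) / sqrt (real N)"
      using elim \<epsilon> K by (intro norm_weighted_avg_exp_sqrt_le B tail) auto
    also have "\<dots> = \<epsilon> + B * \<delta> + C * inverse (sqrt (real N))"
      using elim by (simp add: K_def C_def field_simps)
    also have "\<dots> < r" using elim \<delta> r unfolding \<epsilon>_def by linarith
    finally show ?case
      using weighted_avg_diff_const[of N exp_sqrt f l] exp_sqrt_pos[of N] elim
      by (simp add: g_def dist_norm)
  qed
qed

theorem theorem5p2:
  fixes f :: "nat \<Rightarrow> complex" and l :: complex and W :: "real \<Rightarrow> real"
  assumes f_bounded: "bounded (f ` {1..})"
    and W_eq: "W = (\<lambda>x. exp (sqrt x))"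
  shows "(short_interval_convergent W f l \<longrightarrow>
            (\<lambda>N. weighted_avg (\<lambda>n. W (real n)) f N) \<longlonglongrightarrow> l) \<and>
         ((\<lambda>N. weighted_avg (\<lambda>n. W (real n)) f N) \<longlonglongrightarrow> l \<longrightarrow>
            (\<lambda>N. twobin_avg f N) \<longlonglongrightarrow> l)"
proof -
  have "(\<lambda>n. W (real n)) = exp_sqrt"
    by (auto simp: W_eq exp_sqrt_def)
  then show ?thesis
    using weighted_avg_exp_sqrt_tendsto[OF f_bounded] twobin_avg_tendsto[OF f_bounded]
    by (simp add: W_eq)
qed

end
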